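(* Let $(M,\eta,\phi_1,\phi_2,\phi_3)$ be an almost bi-paracontact manifold. There exists a unique linear connection $\nabla^c$ on $M$ such that (i) $\nabla^c\xi=0$; (ii) $\nabla^c\phi_\alpha=\frac23\,\eta\otimes h_\alpha$ for each $\alpha\in\{1,2,3\}$; (iii) its torsion tensor field $T^c$ satisfies, for all $X,Y\in\Gamma(TM)$, $$T^c(X,Y)=d\eta(X,Y)\xi+\tfrac13\bigl(-d\eta(\phi_1X,\phi_1Y)-d\eta(\phi_2X,\phi_2Y)+d\eta(\phi_3X,\phi_3Y)\bigr)\xi+\tfrac16\bigl(-N^{(1)}_{\phi_1}(X,Y)-N^{(1)}_{\phi_2}(X,Y)+N^{(1)}_{\phi_3}(X,Y)\bigr).$$
   Context: Everything is smooth. A contact manifold $(M,\eta)$ is a $(2n+1)$-dimensional manifold with a $1$-form $\eta$ such that $\eta\wedge(d\eta)^n\neq 0$ everywhere; its Reeb vector field $\xi$ is determined by $\eta(\xi)=1$, $d\eta(\xi,\cdot)=0$. Normalization: $2d\eta(X,Y)=X(\eta(Y))-Y(\eta(X))-\eta([X,Y])$. An almost bi-paracontact structure on $(M,\eta)$ is a triplet $(\phi_1,\phi_2,\phi_3)$ of $(1,1)$-tensor fields with $\phi_1\phi_2=-\phi_2\phi_1$, $\phi_1^2=\phi_2^2=I-\eta\otimes\xi$, $\phi_3=\phi_1\phi_2$, and $\phi_3^2=-I+\eta\otimes\xi$; then $(M,\eta,\phi_1,\phi_2,\phi_3)$ is called an almost bi-paracontact manifold. $h_\alpha:=\frac12\mathcal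 L_\xi\phi_\alpha$ for $\alpha\in\{1,2,3\}$. For a $(1,1)$-tensor field $\phi$, $[\phi,\phi](X,Y)=\phi^2[X,Y]+[\phi X,\phi Y]-\phi[\phi X,Y]-\phi[X,\phi Y]$; $N^{(1)}_{\phi_\alpha}(X,Y)=[\phi_\alpha,\phi_\alpha](X,Y)-2d\eta(X,Y)\xi$ for $\alpha=1,2$, and $N^{(1)}_{\phi_3}(X,Y)=[\phi_3,\phi_3](X,Y)+2d\eta(X,Y)\xi$. $\nabla\phi=\eta\otimes B$ (with $B$ a $(1,1)$-tensor field) means $(\nabla_X\phi)Y=\eta(X)BY$. The torsion is $T(X,Y)=\nabla_XY-\nabla_YX-[X,Y]$. *)

theory Defs
  imports "HOL-Analysis.Analysis" "HOL-Library.Function_Algebras"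
begin

text \<open>
  Addition, subtraction and multiplication of functions, tangent vectors and vector fields are the
  pointwise ones of \<^theory>\<open>HOL-Library.Function_Algebras\<close>.
\<close>

section \<open>Smooth manifolds\<close>

text \<open>\<open>Ck_on k f S\<close> is meant for open \<open>S\<close>; it says that \<open>f\<close> is of class $C^k$ on \<open>S\<close>.\<close>

primrec Ck_on :: "nat \<Rightarrow> ('e::euclidean_space \<Rightarrow> 'f::real_normed_vector) \<Rightarrow> 'e set \<Rightarrow> bool" where
  "Ck_on 0 f S \<longleftrightarrow> continuous_on S f"
| "Ck_on (Suc k) f S \<longleftrightarrow>
     (\<forall>x\<in>S. f differentiable (at x)) \<and> (\<forall>v. Ck_on k (\<lambda>x. frechet_derivative f (at x) v) S)"

definition smooth_on :: "('e::euclidean_space \<Rightarrow> 'f::real_normed_vector) \<Rightarrow> 'e set \<Rightarrow> bool" where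
  "smooth_on f S \<longleftrightarrow> (\<forall>k. Ck_on k f S)"

text \<open>
  The manifold is the whole type \<open>'a\<close>, with its type-class topology (Hausdorff and second countable).
  A chart \<open>(U, \<psi>)\<close> consists of an open set and a homeomorphism \<open>\<psi>\<close> from \<open>U\<close> onto an open subset of
  the model space \<open>'e\<close>; its inverse is \<open>inv_into U \<psi>\<close>.  The dimension is \<open>DIM('e)\<close>.
\<close>

type_synonym ('a, 'e) atlas = "('a set \<times> ('a \<Rightarrow> 'e)) set"

definition smooth_manifold ::
    "('a::{t2_space,second_countable_topology}, 'e::euclidean_space) atlas \<Rightarrow> bool" where
  "smooth_manifold A \<longleftrightarrow>
     (\<forall>(U, \<psi>)\<in>A. open U \<and> open (\<psi> ` U) \<and> homeomorphism U (\<psi> ` U) \<psi> (inv_into U \<psi>)) \<and>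
     (\<Union>(U, \<psi>)\<in>A. U) = UNIV \<and>
     (\<forall>(U, \<psi>)\<in>A. \<forall>(V, \<theta>)\<in>A. smooth_on (\<theta> \<circ> inv_into U \<psi>) (\<psi> ` (U \<inter> V)))"

definition smooth_functions :: "('a, 'e::euclidean_space) atlas \<Rightarrow> ('a \<Rightarrow> real) set" where
  "smooth_functions A = {f. \<forall>(U, \<psi>)\<in>A. smooth_on (f \<circ> inv_into U \<psi>) (\<psi> ` U)}"

section \<open>Vector fields and tensor fields\<close>

type_synonym 'a tvec = "('a \<Rightarrow> real) \<Rightarrow> real"
type_synonym 'a vfield = "'a \<Rightarrow> 'a tvec"

text \<open>
  Tangent vectors at \<open>p\<close> are the derivations at \<open>p\<close> of the algebra of smooth functions.  The last
  clause makes the representing function unique by fixing its irrelevant values.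
\<close>

definition tangent_space :: "('a, 'e::euclidean_space) atlas \<Rightarrow> 'a \<Rightarrow> 'a tvec set" where
  "tangent_space A p = {v.
     (\<forall>f\<in>smooth_functions A. \<forall>g\<in>smooth_functions A. v (f + g) = v f + v g) \<and>
     (\<forall>c. \<forall>f\<in>smooth_functions A. v (\<lambda>x. c * f x) = c * v f) \<and>
     (\<forall>f\<in>smooth_functions A. \<forall>g\<in>smooth_functions A. v (f * g) = v f * g p + f p * v g) \<and>
     (\<forall>f. f \<notin> smooth_functions A \<longrightarrow> v f = 0)}"

definition act :: "'a vfield \<Rightarrow> ('a \<Rightarrow> real) \<Rightarrow> 'a \<Rightarrow> real" where
  "act X f = (\<lambda>p. X p f)"

definition vector_fields :: "('a, 'e::euclidean_space) atlas \<Rightarrow> 'a vfield set" where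
  "vector_fields A = {X. (\<forall>p. X p \<in> tangent_space A p) \<and>
                         (\<forall>f\<in>smooth_functions A. act X f \<in> smooth_functions A)}"

definition tscale :: "real \<Rightarrow> 'a tvec \<Rightarrow> 'a tvec" where
  "tscale c v = (\<lambda>f. c * v f)"

definition vscale :: "('a \<Rightarrow> real) \<Rightarrow> 'a vfield \<Rightarrow> 'a vfield" (infixr "\<odot>" 75) where
  "u \<odot> X = (\<lambda>p. tscale (u p) (X p))"

definition lie_bracket :: "'a vfield \<Rightarrow> 'a vfield \<Rightarrow> 'a vfield" where
  "lie_bracket X Y = (\<lambda>p f. X p (act Y f) - Y p (act X f))"

text \<open>
  One-forms and $(1,1)$-tensor fields are families of linear maps on the tangent spaces; such a
  family is smooth iff it takes smooth vector fields to smooth functions or vector fields.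
\<close>

type_synonym 'a form1 = "'a \<Rightarrow> 'a tvec \<Rightarrow> real"
type_synonym 'a tensor11 = "'a \<Rightarrow> 'a tvec \<Rightarrow> 'a tvec"

definition fapp :: "'a form1 \<Rightarrow> 'a vfield \<Rightarrow> 'a \<Rightarrow> real" where
  "fapp \<eta> X = (\<lambda>p. \<eta> p (X p))"

definition tapp :: "'a tensor11 \<Rightarrow> 'a vfield \<Rightarrow> 'a vfield" where
  "tapp \<phi> X = (\<lambda>p. \<phi> p (X p))"

definition one_form :: "('a, 'e::euclidean_space) atlas \<Rightarrow> 'a form1 \<Rightarrow> bool" where
  "one_form A \<eta> \<longleftrightarrow>
     (\<forall>p. \<forall>v\<in>tangent_space A p. \<forall>w\<in>tangent_space A p. \<eta> p (v + w) = \<eta> p v + \<eta> p w) \<and>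
     (\<forall>p. \<forall>c. \<forall>v\<in>tangent_space A p. \<eta> p (tscale c v) = c * \<eta> p v) \<and>
     (\<forall>X\<in>vector_fields A. fapp \<eta> X \<in> smooth_functions A)"

definition tensor_field11 :: "('a, 'e::euclidean_space) atlas \<Rightarrow> 'a tensor11 \<Rightarrow> bool" where
  "tensor_field11 A \<phi> \<longleftrightarrow>
     (\<forall>p. \<forall>v\<in>tangent_space A p. \<phi> p v \<in> tangent_space A p) \<and>
     (\<forall>p. \<forall>v\<in>tangent_space A p. \<forall>w\<in>tangent_space A p. \<phi> p (v + w) = \<phi> p v + \<phi> p w) \<and>
     (\<forall>p. \<forall>c. \<forall>v\<in>tangent_space A p. \<phi> p (tscale c v) = tscale c (\<phi> p v)) \<and>
     (\<forall>X\<in>vector_fields A. tapp \<phi> X \<in> vector_fields A)"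

text \<open>Exterior derivative of a one-form, in the normalization with the factor $1/2$:
  $2\,d\eta(X,Y) = X(\eta(Y)) - Y(\eta(X)) - \eta([X,Y])$.\<close>

definition ext_d :: "'a form1 \<Rightarrow> 'a vfield \<Rightarrow> 'a vfield \<Rightarrow> 'a \<Rightarrow> real" where
  "ext_d \<eta> X Y = (\<lambda>p. (act X (fapp \<eta> Y) p - act Y (fapp \<eta> X) p - fapp \<eta> (lie_bracket X Y) p) / 2)"

text \<open>
  A differential $k$-form is evaluated on the first $k$ members of a sequence of vector fields.  The
  wedge product is the alternation of the tensor product, with the factor $1/(k+l)!$ that belongs
  to the above normalization of the exterior derivative.
\<close>

type_synonym 'a kform = "(nat \<Rightarrow> 'a vfield) \<Rightarrow> 'a \<Rightarrow> real"

definition wedge :: "nat \<Rightarrow> nat \<Rightarrow> 'a kform \<Rightarrow> 'a kform \<Rightarrow> 'a kform" where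
  "wedge k l \<alpha> \<beta> X = (\<lambda>p. (\<Sum>\<sigma> | \<sigma> permutes {..<k + l}.
      of_int (sign \<sigma>) * \<alpha> (\<lambda>i. X (\<sigma> i)) p * \<beta> (\<lambda>i. X (\<sigma> (k + i))) p) / fact (k + l))"

primrec wedge_power2 :: "'a kform \<Rightarrow> nat \<Rightarrow> 'a kform" where
  "wedge_power2 \<omega> 0 = (\<lambda>X p. 1)"
| "wedge_power2 \<omega> (Suc n) = wedge 2 (2 * n) \<omega> (wedge_power2 \<omega> n)"

section \<open>Contact and almost bi-paracontact manifolds\<close>

definition contact_manifold ::
    "('a::{t2_space,second_countable_topology}, 'e::euclidean_space) atlas \<Rightarrow> nat \<Rightarrow> 'a form1 \<Rightarrow> bool"
where
  "contact_manifold A n \<eta> \<longleftrightarrow>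
     smooth_manifold A \<and> DIM('e) = 2 * n + 1 \<and> one_form A \<eta> \<and>
     (\<forall>p. \<exists>X. (\<forall>i. X i \<in> vector_fields A) \<and>
        wedge 1 (2 * n) (\<lambda>Z. fapp \<eta> (Z 0))
          (wedge_power2 (\<lambda>Z. ext_d \<eta> (Z 0) (Z 1)) n) X p \<noteq> 0)"

definition reeb_field :: "('a, 'e::euclidean_space) atlas \<Rightarrow> 'a form1 \<Rightarrow> 'a vfield \<Rightarrow> bool" where
  "reeb_field A \<eta> \<xi> \<longleftrightarrow>
     \<xi> \<in> vector_fields A \<and> fapp \<eta> \<xi> = 1 \<and> (\<forall>X\<in>vector_fields A. ext_d \<eta> \<xi> X = 0)"

definition almost_bi_paracontact ::
    "('a, 'e::euclidean_space) atlas \<Rightarrow> 'a form1 \<Rightarrow> 'a vfield \<Rightarrow>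
      'a tensor11 \<Rightarrow> 'a tensor11 \<Rightarrow> 'a tensor11 \<Rightarrow> bool"
where
  "almost_bi_paracontact A \<eta> \<xi> \<phi>\<^sub>1 \<phi>\<^sub>2 \<phi>\<^sub>3 \<longleftrightarrow>
     tensor_field11 A \<phi>\<^sub>1 \<and> tensor_field11 A \<phi>\<^sub>2 \<and> tensor_field11 A \<phi>\<^sub>3 \<and>
     (\<forall>p. \<forall>v\<in>tangent_space A p.
        \<phi>\<^sub>1 p (\<phi>\<^sub>2 p v) = - \<phi>\<^sub>2 p (\<phi>\<^sub>1 p v) \<and>
        \<phi>\<^sub>1 p (\<phi>\<^sub>1 p v) = v - tscale (\<eta> p v) (\<xi> p) \<and>
        \<phi>\<^sub>2 p (\<phi>\<^sub>2 p v) = v - tscale (\<eta> p v) (\<xi> p) \<and>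
        \<phi>\<^sub>3 p v = \<phi>\<^sub>1 p (\<phi>\<^sub>2 p v) \<and>
        \<phi>\<^sub>3 p (\<phi>\<^sub>3 p v) = - v + tscale (\<eta> p v) (\<xi> p))"

definition lie_derivative11 :: "'a vfield \<Rightarrow> 'a tensor11 \<Rightarrow> 'a vfield \<Rightarrow> 'a vfield" where
  "lie_derivative11 Z \<phi> X = lie_bracket Z (tapp \<phi> X) - tapp \<phi> (lie_bracket Z X)"

definition h_tensor :: "'a vfield \<Rightarrow> 'a tensor11 \<Rightarrow> 'a vfield \<Rightarrow> 'a vfield" where
  "h_tensor \<xi> \<phi> X = (\<lambda>_. 1/2) \<odot> lie_derivative11 \<xi> \<phi> X"

definition nijenhuis :: "'a tensor11 \<Rightarrow> 'a vfield \<Rightarrow> 'a vfield \<Rightarrow> 'a vfield" where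
  "nijenhuis \<phi> X Y =
     tapp \<phi> (tapp \<phi> (lie_bracket X Y)) + lie_bracket (tapp \<phi> X) (tapp \<phi> Y)
     - tapp \<phi> (lie_bracket (tapp \<phi> X) Y) - tapp \<phi> (lie_bracket X (tapp \<phi> Y))"

text \<open>The tensor $N^{(1)}$ of a structure with $\phi^2 = I - \eta\otimes\xi$ (paracontact sign)
  and with $\phi^2 = -I + \eta\otimes\xi$ (contact sign).\<close>

definition N1_para :: "'a form1 \<Rightarrow> 'a vfield \<Rightarrow> 'a tensor11 \<Rightarrow> 'a vfield \<Rightarrow> 'a vfield \<Rightarrow> 'a vfield" where
  "N1_para \<eta> \<xi> \<phi> X Y = nijenhuis \<phi> X Y - (2 * ext_d \<eta> X Y) \<odot> \<xi>"

definition N1_cont :: "'a form1 \<Rightarrow> 'a vfield \<Rightarrow> 'a tensor11 \<Rightarrow> 'a vfield \<Rightarrow> 'a vfield \<Rightarrow> 'a vfield" where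
  "N1_cont \<eta> \<xi> \<phi> X Y = nijenhuis \<phi> X Y + (2 * ext_d \<eta> X Y) \<odot> \<xi>"

section \<open>Linear connections\<close>

text \<open>\<open>D X Y\<close> stands for $\nabla_X Y$.  The last clause fixes the values of \<open>D\<close> on arguments that are
  not vector fields, so that equality of connections is equality of the representing functions.\<close>

definition linear_connection ::
    "('a, 'e::euclidean_space) atlas \<Rightarrow> ('a vfield \<Rightarrow> 'a vfield \<Rightarrow> 'a vfield) \<Rightarrow> bool"
where
  "linear_connection A D \<longleftrightarrow>
     (\<forall>X\<in>vector_fields A. \<forall>Y\<in>vector_fields A. D X Y \<in> vector_fields A) \<and>
     (\<forall>X\<in>vector_fields A. \<forall>Y\<in>vector_fields A. \<forall>Z\<in>vector_fields A.
        D (X + Y) Z = D X Z + D Y Z \<and> D X (Y + Z) = D X Y + D X Z) \<and>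
     (\<forall>f\<in>smooth_functions A. \<forall>X\<in>vector_fields A. \<forall>Y\<in>vector_fields A.
        D (f \<odot> X) Y = f \<odot> D X Y \<and> D X (f \<odot> Y) = act X f \<odot> Y + f \<odot> D X Y) \<and>
     (\<forall>X Y. X \<notin> vector_fields A \<or> Y \<notin> vector_fields A \<longrightarrow> D X Y = 0)"

definition cov_deriv11 ::
    "('a vfield \<Rightarrow> 'a vfield \<Rightarrow> 'a vfield) \<Rightarrow> 'a tensor11 \<Rightarrow> 'a vfield \<Rightarrow> 'a vfield \<Rightarrow> 'a vfield" where
  "cov_deriv11 D \<phi> X Y = D X (tapp \<phi> Y) - tapp \<phi> (D X Y)"

definition torsion ::
    "('a vfield \<Rightarrow> 'a vfield \<Rightarrow> 'a vfield) \<Rightarrow> 'a vfield \<Rightarrow> 'a vfield \<Rightarrow> 'a vfield" where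
  "torsion D X Y = D X Y - D Y X - lie_bracket X Y"

end

theory Submission
  imports Defs
begin

text \<open>
  Write \<open>P\<close>, \<open>Q\<close>, \<open>J\<close> for $\phi_1$, $\phi_2$, $\phi_3$ and call a field horizontal if \<open>\<eta>\<close> vanishes on it.
  The three tensors kill \<open>\<xi>\<close> and have horizontal values, and on horizontal fields they are the units of
  the split quaternions: $P^2 = Q^2 = 1$, $J^2 = -1$, $PQ = -QP = J$.

  \<^bold>\<open>Uniqueness.\<close> Let \<open>S X Y\<close> be the difference of two such connections.  Equal torsion makes \<open>S\<close>
  symmetric, and equal derivatives of the tensors make it commute with \<open>P\<close> and \<open>Q\<close> in the second
  argument, hence by symmetry in the first one too.  Pulling \<open>P\<close> and \<open>Q\<close> out of $S(PX, QY)$ in the two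
  possible orders gives $QP\,S(X,Y) = PQ\,S(X,Y)$, that is $2J\,S(X,Y) = 0$; since \<open>S\<close> has horizontal
  values (it annihilates \<open>\<xi>\<close> and commutes with $P^2$), it vanishes.

  \<^bold>\<open>Existence.\<close> Since $\nabla\xi = 0$, it is enough to give $\nabla_\xi$ and $\nabla_X$ for horizontal \<open>X\<close>
  on horizontal fields.  Averaging an odd operator \<open>F\<close> over the units,
  $$\bar F = \tfrac14\,(F + PFP + QFQ - JFJ),$$
  makes it commute with \<open>P\<close>, \<open>Q\<close> and \<open>J\<close>, and turns a derivation over the functions into a derivation.
  Let $B(X,Y)$ be the horizontal part of $[X,Y]$.  The average of $B(X,\cdot)$ is already parallel and
  satisfies the Leibniz rule in \<open>Y\<close>, but it is not tensorial in \<open>X\<close>.  This is repaired by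
  $$E(X,Y) = B(X,Y) - \tfrac13\,\bigl(B(PX,PY) + B(QX,QY) - B(JX,JY)\bigr),$$
  whose average in \<open>Y\<close> is the required $\nabla_X Y$, an analogue of the Obata connection of a
  hypercomplex structure; its torsion comes out as the combination of Nijenhuis tensors in the
  statement.  In the Reeb direction
  $\nabla_\xi = \tfrac13\,\mathcal{L}_\xi + \tfrac23\,\overline{\mathcal{L}_\xi}$:
  the averaged part commutes with the tensors, so that
  $\nabla_\xi\phi_\alpha = \tfrac13\,\mathcal{L}_\xi\phi_\alpha = \tfrac23\,h_\alpha$.

  The torsion identity is one between skew-symmetric tensorial maps, so it has to be checked only
  on two horizontal fields and on \<open>\<xi>\<close> with a horizontal field (\<open>skew_tensor_eqI\<close>).  There it is a linear
  identity between brackets, read off from the multiplication table of the units.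
\<close>

section \<open>Smooth functions\<close>

lemma Ck_on_Suc_imp: "Ck_on (Suc k) f S \<Longrightarrow> Ck_on k f S"
proof (induction k arbitrary: f)
  case 0
  then show ?case
    by (auto intro!: continuous_at_imp_continuous_on differentiable_imp_continuous_within)
next
  case (Suc k)
  then show ?case by (metis Ck_on.simps(2))
qed

text \<open>
  Higher derivatives of sums and products are known only on the open set, so replacing them by
  their formulas needs an extensionality principle relative to that set.
\<close>

lemma Ck_on_cong:
  assumes "open S" "\<And>x. x \<in> S \<Longrightarrow> f x = g x"
  shows "Ck_on k f S \<longleftrightarrow> Ck_on k g S"
  using assms(2)
proof (induction k arbitrary: f g)
  case 0
  then show ?case by (simp cong: continuous_on_cong)
next
  case (Suc k)
  have D: "(f has_derivative f') (at x) \<longleftrightarrow> (g has_derivative f') (at x)" if "x \<in> S" for x f'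
    using has_derivative_transform_within_open[OF _ assms(1) that] Suc.prems by metis
  have "frechet_derivative f (at x) = frechet_derivative g (at x)" if "x \<in> S" for x
    using D[OF that] by (simp add: frechet_derivative_def)
  then have "Ck_on k (\<lambda>x. frechet_derivative f (at x) v) S
      \<longleftrightarrow> Ck_on k (\<lambda>x. frechet_derivative g (at x) v) S" for v
    by (intro Suc.IH) simp
  then show ?case using D by (auto simp: differentiable_def)
qed

lemma Ck_on_const: "Ck_on k (\<lambda>_. c) S"
  by (induction k arbitrary: c) auto

lemma Ck_on_add:
  assumes "open S" "Ck_on k f S" "Ck_on k g S"
  shows "Ck_on k (\<lambda>x. f x + g x) S"
  using assms(2,3)
proof (induction k arbitrary: f g)
  case (Suc k)
  have "Ck_on k (\<lambda>x. frechet_derivative f (at x) v + frechet_derivative g (at x) v) S" for v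
    using Suc by simp
  moreover have "frechet_derivative (\<lambda>x. f x + g x) (at x) v
      = frechet_derivative f (at x) v + frechet_derivative g (at x) v" if "x \<in> S" for x v
    using Suc.prems that
    by (intro arg_cong[where f="\<lambda>h. h v", OF frechet_derivative_at[symmetric], THEN trans]
        has_derivative_add) (auto simp: frechet_derivative_works)
  ultimately have "Ck_on k (\<lambda>x. frechet_derivative (\<lambda>x. f x + g x) (at x) v) S" for v
    by (subst Ck_on_cong[OF assms(1)]) auto
  then show ?case using Suc.prems by auto
qed (auto intro: continuous_on_add)

lemma Ck_on_mult:
  fixes f g :: "'e::euclidean_space \<Rightarrow> real"
  assumes "open S" "Ck_on k f S" "Ck_on k g S"
  shows "Ck_on k (\<lambda>x. f x * g x) S"
  using assms(2,3)
proof (induction k arbitrary: f g)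
  case (Suc k)
  have "Ck_on k (\<lambda>x. f x * frechet_derivative g (at x) v + frechet_derivative f (at x) v * g x) S" for v
    using Suc by (intro Ck_on_add[OF assms(1)] Suc.IH) (auto dest: Ck_on_Suc_imp simp del: Ck_on.simps(2), auto)
  moreover have "frechet_derivative (\<lambda>x. f x * g x) (at x) v
      = f x * frechet_derivative g (at x) v + frechet_derivative f (at x) v * g x" if "x \<in> S" for x v
    using Suc.prems that
    by (intro arg_cong[where f="\<lambda>h. h v", OF frechet_derivative_at[symmetric], THEN trans]
        has_derivative_mult) (auto simp: frechet_derivative_works)
  ultimately have "Ck_on k (\<lambda>x. frechet_derivative (\<lambda>x. f x * g x) (at x) v) S" for v
    by (subst Ck_on_cong[OF assms(1)]) auto
  then show ?case using Suc.prems by auto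
qed (auto intro: continuous_on_mult)

lemma smooth_functions_const [simp]: "(\<lambda>_. c) \<in> smooth_functions A"
  by (auto simp: smooth_functions_def smooth_on_def comp_def Ck_on_const)

lemma smooth_functions_0 [simp]: "0 \<in> smooth_functions A"
  by (simp add: zero_fun_def)

lemma open_chart_image: "smooth_manifold A \<Longrightarrow> (U, \<psi>) \<in> A \<Longrightarrow> open (\<psi> ` U)"
  by (auto simp: smooth_manifold_def)

lemma smooth_functions_add:
  assumes "smooth_manifold A" "f \<in> smooth_functions A" "g \<in> smooth_functions A"
  shows "f + g \<in> smooth_functions A"
  using assms(2,3) open_chart_image[OF assms(1)]
  by (fastforce simp: smooth_functions_def smooth_on_def comp_def plus_fun_def intro: Ck_on_add)

lemma smooth_functions_mult:
  assumes "smooth_manifold A" "f \<in> smooth_functions A" "g \<in> smooth_functions A"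
  shows "f * g \<in> smooth_functions A"
  using assms(2,3) open_chart_image[OF assms(1)]
  by (fastforce simp: smooth_functions_def smooth_on_def comp_def times_fun_def intro: Ck_on_mult)

section \<open>Vector fields\<close>

lemma vscale_apply [simp]: "(u \<odot> X) p f = u p * X p f"
  by (simp add: vscale_def tscale_def)

lemma vscale_0 [simp]: "0 \<odot> X = 0" "u \<odot> (0 :: 'a vfield) = 0"
  by (auto simp: fun_eq_iff)

lemma vscale_1 [simp]: "1 \<odot> X = X"
  by (auto simp: fun_eq_iff)

locale manifold =
  fixes A :: "('a::{t2_space,second_countable_topology}, 'e::euclidean_space) atlas"
  assumes manifold: "smooth_manifold A"
begin

abbreviation "SF \<equiv> smooth_functions A"
abbreviation "VF \<equiv> vector_fields A"
abbreviation "TS \<equiv> tangent_space A"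

lemmas SF_closed [simp] = smooth_functions_add[OF manifold] smooth_functions_mult[OF manifold]

lemma SF_uminus [simp]: "f \<in> SF \<Longrightarrow> - f \<in> SF"
  using SF_closed(2)[of "\<lambda>_. - 1" f] by (simp add: times_fun_def fun_Compl_def)

lemma SF_diff [simp]: "f \<in> SF \<Longrightarrow> g \<in> SF \<Longrightarrow> f - g \<in> SF"
  using SF_closed(1)[of f "- g"] by simp

lemma TS_plus_apply: "v \<in> TS p \<Longrightarrow> f \<in> SF \<Longrightarrow> g \<in> SF \<Longrightarrow> v (f + g) = v f + v g"
  and TS_mult_apply: "v \<in> TS p \<Longrightarrow> f \<in> SF \<Longrightarrow> g \<in> SF \<Longrightarrow> v (f * g) = v f * g p + f p * v g"
  and TS_scale_apply: "v \<in> TS p \<Longrightarrow> f \<in> SF \<Longrightarrow> v (\<lambda>x. c * f x) = c * v f"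
  and TS_outside: "v \<in> TS p \<Longrightarrow> f \<notin> SF \<Longrightarrow> v f = 0"
  unfolding tangent_space_def by blast+

lemma TS_I:
  assumes "\<And>f g. f \<in> SF \<Longrightarrow> g \<in> SF \<Longrightarrow> v (f + g) = v f + v g"
    and "\<And>c f. f \<in> SF \<Longrightarrow> v (\<lambda>x. c * f x) = c * v f"
    and "\<And>f g. f \<in> SF \<Longrightarrow> g \<in> SF \<Longrightarrow> v (f * g) = v f * g p + f p * v g"
    and "\<And>f. f \<notin> SF \<Longrightarrow> v f = 0"
  shows "v \<in> TS p"
  unfolding tangent_space_def using assms by blast

lemma TS_scale: assumes v: "v \<in> TS p" shows "tscale c v \<in> TS p"
  by (rule TS_I) (simp_all only: tscale_def TS_plus_apply[OF v] TS_mult_apply[OF v]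
    TS_scale_apply[OF v] TS_outside[OF v] not_False_eq_True mult_zero_right algebra_simps)

lemma TS_add: assumes v: "v \<in> TS p" and w: "w \<in> TS p" shows "v + w \<in> TS p"
  by (rule TS_I) (simp_all only: plus_fun_apply TS_plus_apply[OF v] TS_mult_apply[OF v]
    TS_scale_apply[OF v] TS_outside[OF v] TS_plus_apply[OF w] TS_mult_apply[OF w]
    TS_scale_apply[OF w] TS_outside[OF w] not_False_eq_True add_0 algebra_simps)

lemma TS_0 [simp]: "0 \<in> TS p"
  by (rule TS_I) simp_all

text \<open>
  Derivations kill constants because $1 \cdot 1 = 1$.
\<close>

lemma TS_const: "v \<in> TS p \<Longrightarrow> v (\<lambda>_. c) = 0"
proof -
  assume v: "v \<in> TS p"
  have "v (\<lambda>_. 1) = 0"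
    using TS_mult_apply[OF v, of "\<lambda>_. 1" "\<lambda>_. 1"] by (simp add: times_fun_def)
  then show ?thesis
    using TS_scale_apply[OF v, of "\<lambda>_. 1" c] by simp
qed

lemma VF_TS: "X \<in> VF \<Longrightarrow> X p \<in> TS p"
  by (simp add: vector_fields_def)

lemma VF_I: "(\<And>p. X p \<in> TS p) \<Longrightarrow> (\<And>f. f \<in> SF \<Longrightarrow> act X f \<in> SF) \<Longrightarrow> X \<in> VF"
  by (simp add: vector_fields_def)

text \<open>
  Off the smooth functions a tangent vector takes the default value \<open>0\<close>.  Hence \<open>act X f\<close> is smooth for
  every \<open>f\<close>, and bracket identities hold as equalities of functions without a case distinction.
\<close>

lemma act_outside:
  assumes "X \<in> VF" "f \<notin> SF"
  shows "act X f = 0"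
  using TS_outside[OF VF_TS[OF assms(1)] assms(2)] by (simp add: act_def fun_eq_iff)

lemma act_SF [simp]: "X \<in> VF \<Longrightarrow> act X f \<in> SF"
  by (cases "f \<in> SF") (simp_all add: act_outside, simp add: vector_fields_def)

lemma act_add_field: "act (X + Y) f = act X f + act Y f"
  and act_scale_field: "act (u \<odot> X) f = u * act X f"
  and act_minus_field: "act (- X) f = - act X f"
  and act_zero_field: "act 0 f = 0"
  by (auto simp: act_def fun_eq_iff)

lemma act_add: "X \<in> VF \<Longrightarrow> f \<in> SF \<Longrightarrow> g \<in> SF \<Longrightarrow> act X (f + g) = act X f + act X g"
  unfolding act_def using TS_plus_apply[OF VF_TS, of X f g] by (simp add: fun_eq_iff)

lemma act_mult: "X \<in> VF \<Longrightarrow> f \<in> SF \<Longrightarrow> g \<in> SF \<Longrightarrow> act X (f * g) = act X f * g + f * act X g"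
  unfolding act_def using TS_mult_apply[OF VF_TS, of X f g] by (simp add: fun_eq_iff)

lemma act_const: assumes "X \<in> VF" shows "act X (\<lambda>_. c) = 0" "act X 0 = 0" "act X 1 = 0"
proof -
  show "act X (\<lambda>_. c) = 0" for c
    unfolding act_def using TS_const[OF VF_TS[OF assms], of _ c] by (simp add: fun_eq_iff)
  from this[of 0] this[of 1] show "act X 0 = 0" "act X 1 = 0"
    by (simp_all only: zero_fun_def one_fun_def)
qed

lemma VF_0 [simp]: "0 \<in> VF"
  by (rule VF_I) (simp_all add: act_zero_field)

lemma VF_scale [simp]: "u \<in> SF \<Longrightarrow> X \<in> VF \<Longrightarrow> u \<odot> X \<in> VF"
  by (rule VF_I) (simp add: vscale_def TS_scale VF_TS, simp add: act_scale_field)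

lemma VF_add [simp]: "X \<in> VF \<Longrightarrow> Y \<in> VF \<Longrightarrow> X + Y \<in> VF"
  by (rule VF_I) (simp_all add: act_add_field TS_add VF_TS)

lemma uminus_vscale: "- X = (\<lambda>_. - 1) \<odot> X"
  by (auto simp: fun_eq_iff)

lemma VF_minus [simp]: "X \<in> VF \<Longrightarrow> - X \<in> VF"
  using VF_scale[of "\<lambda>_. -1" X] by (simp only: uminus_vscale[of X]) simp

lemma VF_diff [simp]: "X \<in> VF \<Longrightarrow> Y \<in> VF \<Longrightarrow> X - Y \<in> VF"
  using VF_add[of X "- Y"] by simp

section \<open>Lie brackets\<close>

lemma act_bracket: "act (lie_bracket X Y) f = act X (act Y f) - act Y (act X f)"
  by (auto simp: act_def lie_bracket_def fun_eq_iff)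

lemma bracket_VF [simp]:
  assumes X: "X \<in> VF" and Y: "Y \<in> VF"
  shows "lie_bracket X Y \<in> VF"
proof -
  note [simp] = X Y
  have app: "lie_bracket X Y p f = act X (act Y f) p - act Y (act X f) p" for p f
    by (simp add: lie_bracket_def act_def)
  have "lie_bracket X Y p \<in> TS p" for p
  proof (rule TS_I)
    fix f g assume [simp]: "f \<in> SF" "g \<in> SF"
    show "lie_bracket X Y p (f + g) = lie_bracket X Y p f + lie_bracket X Y p g"
      by (simp add: app act_add)
    show "lie_bracket X Y p (f * g) = lie_bracket X Y p f * g p + f p * lie_bracket X Y p g"
      by (simp add: app act_mult act_add algebra_simps)
  next
    fix c f assume [simp]: "f \<in> SF"
    have "(\<lambda>x. c * f x) = (\<lambda>_. c) * f" by (simp add: times_fun_def)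
    then show "lie_bracket X Y p (\<lambda>x. c * f x) = c * lie_bracket X Y p f"
      by (simp add: app act_mult act_const act_add algebra_simps)
  next
    fix f assume "f \<notin> SF"
    then have "act X f = 0" "act Y f = 0"
      by (simp_all add: act_outside)
    then show "lie_bracket X Y p f = 0"
      by (simp add: app act_const)
  qed
  then show ?thesis
    by (rule VF_I) (simp add: act_bracket)
qed

lemma bracket_eq_iff: "lie_bracket X Y p f = act X (act Y f) p - act Y (act X f) p"
  by (simp add: lie_bracket_def act_def)

lemma bracket_swap: "lie_bracket Y X = - lie_bracket X Y"
  by (simp add: fun_eq_iff bracket_eq_iff)

lemma bracket_self [simp]: "lie_bracket X X = 0"
  by (simp add: fun_eq_iff bracket_eq_iff)

lemma bracket_add_left:
  assumes "X \<in> VF" "Y \<in> VF" "Z \<in> VF"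
  shows "lie_bracket (X + Y) Z = lie_bracket X Z + lie_bracket Y Z"
  using assms by (simp add: fun_eq_iff bracket_eq_iff act_add act_add_field)

lemma bracket_scale_left:
  assumes "X \<in> VF" "Y \<in> VF" "u \<in> SF"
  shows "lie_bracket (u \<odot> X) Y = u \<odot> lie_bracket X Y - act Y u \<odot> X"
  using assms
  by (simp add: fun_eq_iff bracket_eq_iff act_mult act_scale_field algebra_simps) (simp add: act_def)

lemma bracket_add_right:
  "X \<in> VF \<Longrightarrow> Y \<in> VF \<Longrightarrow> Z \<in> VF \<Longrightarrow> lie_bracket Z (X + Y) = lie_bracket Z X + lie_bracket Z Y"
  unfolding bracket_swap[of Z] by (simp add: bracket_add_left)

lemma bracket_scale_right:
  "X \<in> VF \<Longrightarrow> Y \<in> VF \<Longrightarrow> u \<in> SF \<Longrightarrow> lie_bracket X (u \<odot> Y) = u \<odot> lie_bracket X Y + act X u \<odot> Y"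
  unfolding bracket_swap[of X] by (simp add: bracket_scale_left fun_eq_iff)

lemma bracket_minus_left: "X \<in> VF \<Longrightarrow> Y \<in> VF \<Longrightarrow> lie_bracket (- X) Y = - lie_bracket X Y"
  using bracket_scale_left[of X Y "\<lambda>_. -1"] by (simp add: act_const uminus_vscale[symmetric])

lemma bracket_minus_right: "X \<in> VF \<Longrightarrow> Y \<in> VF \<Longrightarrow> lie_bracket X (- Y) = - lie_bracket X Y"
  unfolding bracket_swap[of X] by (simp add: bracket_minus_left)

lemma bracket_0 [simp]: "X \<in> VF \<Longrightarrow> lie_bracket X 0 = 0" "X \<in> VF \<Longrightarrow> lie_bracket 0 X = 0"
  by (simp_all add: fun_eq_iff bracket_eq_iff act_const act_zero_field)

section \<open>One-forms and tensor fields acting on vector fields\<close>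

lemma fapp_add: "one_form A \<eta> \<Longrightarrow> X \<in> VF \<Longrightarrow> Y \<in> VF \<Longrightarrow> fapp \<eta> (X + Y) = fapp \<eta> X + fapp \<eta> Y"
  and fapp_scale: "one_form A \<eta> \<Longrightarrow> X \<in> VF \<Longrightarrow> fapp \<eta> (u \<odot> X) = u * fapp \<eta> X"
  and fapp_SF: "one_form A \<eta> \<Longrightarrow> X \<in> VF \<Longrightarrow> fapp \<eta> X \<in> SF"
  by (auto simp: one_form_def fapp_def fun_eq_iff VF_TS vscale_def)

lemma fapp_minus: "one_form A \<eta> \<Longrightarrow> X \<in> VF \<Longrightarrow> fapp \<eta> (- X) = - fapp \<eta> X"
  unfolding uminus_vscale by (simp add: fapp_scale fun_eq_iff)

lemma fapp_diff: "one_form A \<eta> \<Longrightarrow> X \<in> VF \<Longrightarrow> Y \<in> VF \<Longrightarrow> fapp \<eta> (X - Y) = fapp \<eta> X - fapp \<eta> Y"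
  using fapp_add[of \<eta> X "- Y"] by (simp add: fapp_minus)

lemma tapp_add: "tensor_field11 A \<phi> \<Longrightarrow> X \<in> VF \<Longrightarrow> Y \<in> VF \<Longrightarrow> tapp \<phi> (X + Y) = tapp \<phi> X + tapp \<phi> Y"
  and tapp_scale: "tensor_field11 A \<phi> \<Longrightarrow> X \<in> VF \<Longrightarrow> tapp \<phi> (u \<odot> X) = u \<odot> tapp \<phi> X"
  and tapp_VF: "tensor_field11 A \<phi> \<Longrightarrow> X \<in> VF \<Longrightarrow> tapp \<phi> X \<in> VF"
  unfolding tensor_field11_def tapp_def
  by (auto simp: fun_eq_iff[where f="\<lambda>p. \<phi> p _"] VF_TS vscale_def)

lemma tapp_minus: "tensor_field11 A \<phi> \<Longrightarrow> X \<in> VF \<Longrightarrow> tapp \<phi> (- X) = - tapp \<phi> X"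
  unfolding uminus_vscale by (rule tapp_scale)

lemma tapp_diff: "tensor_field11 A \<phi> \<Longrightarrow> X \<in> VF \<Longrightarrow> Y \<in> VF \<Longrightarrow> tapp \<phi> (X - Y) = tapp \<phi> X - tapp \<phi> Y"
  using tapp_add[of \<phi> X "- Y"] by (simp add: tapp_minus)

lemma tapp_0: "tensor_field11 A \<phi> \<Longrightarrow> tapp \<phi> 0 = 0"
  using tapp_diff[of \<phi> 0 0] by simp

end

section \<open>Almost bi-paracontact structures\<close>

text \<open>
  With $\phi\xi = x\xi$, the square $\phi^2\xi = x^2\xi$ must vanish, so \<open>x = 0\<close>; then comparing
  $\phi(\phi^2 X)$ with $\phi^2(\phi X)$ shows that \<open>\<phi>\<close> has values in the kernel of \<open>\<eta>\<close>.
\<close>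

lemma (in manifold) square_tensor_reeb:
  assumes \<phi>: "tensor_field11 A \<phi>" and \<eta>: "one_form A \<eta>" and \<xi>: "\<xi> \<in> VF" "fapp \<eta> \<xi> = 1"
    and sq: "\<And>X. X \<in> VF \<Longrightarrow> tapp \<phi> (tapp \<phi> X) = X - fapp \<eta> X \<odot> \<xi>"
  shows "tapp \<phi> \<xi> = 0" and "X \<in> VF \<Longrightarrow> fapp \<eta> (tapp \<phi> X) = 0"
proof -
  note [simp] = \<xi> tapp_0[OF \<phi>] tapp_VF[OF \<phi>] tapp_scale[OF \<phi>] tapp_diff[OF \<phi>]
    fapp_SF[OF \<eta>] fapp_scale[OF \<eta>]
  define x where "x = fapp \<eta> (tapp \<phi> \<xi>)"
  have [simp]: "x \<in> SF" by (simp add: x_def)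
  have sq_\<xi>: "tapp \<phi> (tapp \<phi> \<xi>) = 0"
    by (simp add: sq)
  then have *: "tapp \<phi> \<xi> = x \<odot> \<xi>"
    using sq[of "tapp \<phi> \<xi>"] by (simp add: x_def)
  have "fapp \<eta> (tapp \<phi> (tapp \<phi> \<xi>)) = x * x"
    by (simp add: *)
  moreover have "fapp \<eta> 0 = 0"
    using fapp_scale[OF \<eta> \<xi>(1), of 0] by simp
  ultimately have "x * x = 0"
    by (simp add: sq_\<xi>)
  then have "x = 0"
    by (simp add: fun_eq_iff)
  then show \<phi>\<xi>: "tapp \<phi> \<xi> = 0"
    by (simp add: *)
  assume X: "X \<in> VF"
  note [simp] = X \<phi>\<xi>
  have "tapp \<phi> (tapp \<phi> (tapp \<phi> X)) = tapp \<phi> X"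
    by (simp add: sq[OF X])
  then have "fapp \<eta> (tapp \<phi> X) \<odot> \<xi> = 0"
    using sq[of "tapp \<phi> X"] by simp
  then have "fapp \<eta> (fapp \<eta> (tapp \<phi> X) \<odot> \<xi>) = 0"
    using \<open>fapp \<eta> 0 = 0\<close> by simp
  then show "fapp \<eta> (tapp \<phi> X) = 0"
    by simp
qed

locale bi_paracontact = manifold A
  for A :: "('a::{t2_space,second_countable_topology}, 'e::euclidean_space) atlas" +
  fixes \<eta> :: "'a form1" and \<xi> :: "'a vfield" and \<phi>\<^sub>1 \<phi>\<^sub>2 \<phi>\<^sub>3 :: "'a tensor11"
  assumes one_form: "one_form A \<eta>"
    and reeb: "reeb_field A \<eta> \<xi>"
    and bi_para: "almost_bi_paracontact A \<eta> \<xi> \<phi>\<^sub>1 \<phi>\<^sub>2 \<phi>\<^sub>3"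
begin

abbreviation "P \<equiv> tapp \<phi>\<^sub>1"
abbreviation "Q \<equiv> tapp \<phi>\<^sub>2"
abbreviation "J \<equiv> tapp \<phi>\<^sub>3"
abbreviation "br \<equiv> lie_bracket"
abbreviation "et \<equiv> fapp \<eta>"

lemma tensors: "tensor_field11 A \<phi>\<^sub>1" "tensor_field11 A \<phi>\<^sub>2" "tensor_field11 A \<phi>\<^sub>3"
  using bi_para by (auto simp: almost_bi_paracontact_def)

lemma \<xi>_VF [simp]: "\<xi> \<in> VF" and et_\<xi> [simp]: "et \<xi> = 1"
  using reeb by (auto simp: reeb_field_def)

lemmas P_rules [simp] = tapp_VF[OF tensors(1)] tapp_add[OF tensors(1)] tapp_diff[OF tensors(1)]
  tapp_minus[OF tensors(1)] tapp_scale[OF tensors(1)] tapp_0[OF tensors(1)]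
lemmas Q_rules [simp] = tapp_VF[OF tensors(2)] tapp_add[OF tensors(2)] tapp_diff[OF tensors(2)]
  tapp_minus[OF tensors(2)] tapp_scale[OF tensors(2)] tapp_0[OF tensors(2)]
lemmas J_rules [simp] = tapp_VF[OF tensors(3)] tapp_add[OF tensors(3)] tapp_diff[OF tensors(3)]
  tapp_minus[OF tensors(3)] tapp_scale[OF tensors(3)] tapp_0[OF tensors(3)]
lemmas et_rules [simp] = fapp_SF[OF one_form] fapp_add[OF one_form] fapp_diff[OF one_form]
  fapp_minus[OF one_form] fapp_scale[OF one_form]

lemma et_0 [simp]: "et 0 = 0"
  using et_rules(5)[of \<xi> 0] by simp

lemma
  assumes "X \<in> VF"
  shows PP: "P (P X) = X - et X \<odot> \<xi>"
    and QQ: "Q (Q X) = X - et X \<odot> \<xi>"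
    and JJ: "J (J X) = et X \<odot> \<xi> - X"
    and PQ: "P (Q X) = J X"
    and QP: "Q (P X) = - J X"
proof -
  note * = bi_para[unfolded almost_bi_paracontact_def, THEN conjunct2, THEN conjunct2, THEN conjunct2,
      rule_format, OF VF_TS[OF assms]]
  show "P (P X) = X - et X \<odot> \<xi>" "Q (Q X) = X - et X \<odot> \<xi>" "P (Q X) = J X"
    by (rule ext, simp only: tapp_def fapp_def vscale_def * fun_diff_def)+
  show "J (J X) = et X \<odot> \<xi> - X"
  proof (rule ext)
    fix p
    have "J (J X) p = - X p + tscale (\<eta> p (X p)) (\<xi> p)"
      unfolding tapp_def using *[of p] by blast
    also have "\<dots> = (et X \<odot> \<xi> - X) p"
      by (simp add: fapp_def vscale_def)
    finally show "J (J X) p = (et X \<odot> \<xi> - X) p" .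
  qed
  show "Q (P X) = - J X"
  proof (rule ext)
    fix p
    have "- (\<phi>\<^sub>2 p (\<phi>\<^sub>1 p (X p))) = \<phi>\<^sub>3 p (X p)"
      using *[of p] by auto
    then show "Q (P X) p = (- J X) p"
      by (simp add: tapp_def flip: \<open>- _ = _\<close>)
  qed
qed

lemma P_\<xi> [simp]: "P \<xi> = 0" and et_P [simp]: "X \<in> VF \<Longrightarrow> et (P X) = 0"
  using square_tensor_reeb[OF tensors(1) one_form \<xi>_VF et_\<xi> PP] by auto

lemma Q_\<xi> [simp]: "Q \<xi> = 0" and et_Q [simp]: "X \<in> VF \<Longrightarrow> et (Q X) = 0"
  using square_tensor_reeb[OF tensors(2) one_form \<xi>_VF et_\<xi> QQ] by auto

lemma J_\<xi> [simp]: "J \<xi> = 0" and et_J [simp]: "X \<in> VF \<Longrightarrow> et (J X) = 0"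
  using PQ[of \<xi>] PQ[of X] et_P[of "Q X"] by auto

lemma et_bracket_\<xi>: "X \<in> VF \<Longrightarrow> et (br \<xi> X) = act \<xi> (et X)"
  using reeb act_const[of X] by (auto simp: reeb_field_def ext_d_def fun_eq_iff)

section \<open>Horizontal fields\<close>

definition horizontal :: "'a vfield set" where
  "horizontal = {X \<in> VF. et X = 0}"

definition hpart :: "'a vfield \<Rightarrow> 'a vfield" where
  "hpart X = X - et X \<odot> \<xi>"

lemma horizontal_VF: "X \<in> horizontal \<Longrightarrow> X \<in> VF" and et_hor: "X \<in> horizontal \<Longrightarrow> et X = 0"
  by (auto simp: horizontal_def)

lemma horizontal_closed [simp]:
  "0 \<in> horizontal"
  "X \<in> horizontal \<Longrightarrow> Y \<in> horizontal \<Longrightarrow> X + Y \<in> horizontal"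
  "X \<in> horizontal \<Longrightarrow> Y \<in> horizontal \<Longrightarrow> X - Y \<in> horizontal"
  "X \<in> horizontal \<Longrightarrow> - X \<in> horizontal"
  "X \<in> horizontal \<Longrightarrow> u \<in> SF \<Longrightarrow> u \<odot> X \<in> horizontal"
  "X \<in> VF \<Longrightarrow> P X \<in> horizontal" "X \<in> VF \<Longrightarrow> Q X \<in> horizontal" "X \<in> VF \<Longrightarrow> J X \<in> horizontal"
  "X \<in> VF \<Longrightarrow> hpart X \<in> horizontal"
  "X \<in> horizontal \<Longrightarrow> br \<xi> X \<in> horizontal"
  by (auto simp: horizontal_def hpart_def et_bracket_\<xi> act_const)

declare horizontal_VF [simp] et_hor [simp]

lemma hpart_hor [simp]: "X \<in> horizontal \<Longrightarrow> hpart X = X"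
  by (simp add: hpart_def)

lemma hpart_linear [simp]:
  "X \<in> VF \<Longrightarrow> Y \<in> VF \<Longrightarrow> hpart (X + Y) = hpart X + hpart Y"
  "X \<in> VF \<Longrightarrow> Y \<in> VF \<Longrightarrow> hpart (X - Y) = hpart X - hpart Y"
  "X \<in> VF \<Longrightarrow> hpart (- X) = - hpart X"
  "X \<in> VF \<Longrightarrow> hpart (u \<odot> X) = u \<odot> hpart X"
  "hpart 0 = 0" "hpart \<xi> = 0"
  by (auto simp: hpart_def fun_eq_iff algebra_simps)

lemma tensors_hpart [simp]: "X \<in> VF \<Longrightarrow> P (hpart X) = P X" "X \<in> VF \<Longrightarrow> Q (hpart X) = Q X" "X \<in> VF \<Longrightarrow> J (hpart X) = J X"
  by (simp_all add: hpart_def)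

text \<open>
  The multiplication table of the split quaternions.  Used as rewriting rules, these equations
  bring every composition of the tensors on a horizontal field to a single unit, which is what
  makes the identities below a matter of collecting terms.
\<close>

lemma split_quaternion_table [simp]:
  assumes "X \<in> horizontal"
  shows "P (P X) = X" "Q (Q X) = X" "J (J X) = - X"
    "P (Q X) = J X" "Q (P X) = - J X" "P (J X) = Q X" "J (P X) = - Q X"
    "Q (J X) = - P X" "J (Q X) = P X"
proof -
  have [simp]: "X \<in> VF" "et X = 0" using assms by auto
  show PP': "P (P X) = X" and QQ': "Q (Q X) = X" and "J (J X) = - X"
    "P (Q X) = J X" "Q (P X) = - J X"
    by (simp_all add: PP QQ JJ PQ QP)
  show "P (J X) = Q X" by (simp add: PQ[symmetric] PP)
  show JQ: "J (Q X) = P X" using PQ[of "Q X"] by (simp add: QQ')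
  show "Q (J X) = - P X" using QP[of "Q X"] by (simp add: PQ JQ)
  have "J (P X) = - Q (P (P X))" by (simp only: QP P_rules \<open>X \<in> VF\<close> minus_minus)
  then show "J (P X) = - Q X" by (simp add: PP')
qed

definition hbracket :: "'a vfield \<Rightarrow> 'a vfield \<Rightarrow> 'a vfield" where
  "hbracket X Y = hpart (br X Y)"

lemma hbracket_hor [simp]: "X \<in> VF \<Longrightarrow> Y \<in> VF \<Longrightarrow> hbracket X Y \<in> horizontal"
  by (simp add: hbracket_def)

lemma hbracket_rules [simp]:
  "X \<in> horizontal \<Longrightarrow> Y \<in> horizontal \<Longrightarrow> Z \<in> horizontal \<Longrightarrow> hbracket (X + Y) Z = hbracket X Z + hbracket Y Z"
  "X \<in> horizontal \<Longrightarrow> Y \<in> horizontal \<Longrightarrow> Z \<in> horizontal \<Longrightarrow> hbracket X (Y + Z) = hbracket X Y + hbracket X Z"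
  "X \<in> horizontal \<Longrightarrow> Y \<in> horizontal \<Longrightarrow> hbracket (- X) Y = - hbracket X Y"
  "X \<in> horizontal \<Longrightarrow> Y \<in> horizontal \<Longrightarrow> hbracket X (- Y) = - hbracket X Y"
  "X \<in> horizontal \<Longrightarrow> Y \<in> horizontal \<Longrightarrow> u \<in> SF \<Longrightarrow> hbracket (u \<odot> X) Y = u \<odot> hbracket X Y - act Y u \<odot> X"
  "X \<in> horizontal \<Longrightarrow> Y \<in> horizontal \<Longrightarrow> u \<in> SF \<Longrightarrow> hbracket X (u \<odot> Y) = u \<odot> hbracket X Y + act X u \<odot> Y"
  by (simp_all add: hbracket_def bracket_add_left bracket_add_right bracket_minus_left bracket_minus_right
      bracket_scale_left bracket_scale_right)

lemma hbracket_swap: "X \<in> VF \<Longrightarrow> Y \<in> VF \<Longrightarrow> hbracket Y X = - hbracket X Y"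
  unfolding hbracket_def by (subst bracket_swap) simp

section \<open>Averaging over the units\<close>

definition average :: "('a vfield \<Rightarrow> 'a vfield) \<Rightarrow> 'a vfield \<Rightarrow> 'a vfield" where
  "average F Y = (\<lambda>_. 1/4) \<odot> (F Y + P (F (P Y)) + Q (F (Q Y)) - J (F (J Y)))"

text \<open>
  Replacing \<open>Y\<close> by its image under a unit permutes the four summands up to that unit; the signs
  from the multiplication table are absorbed by the oddness of \<open>F\<close>.
\<close>

lemma average_parallel:
  assumes F: "\<And>V. V \<in> horizontal \<Longrightarrow> F V \<in> horizontal" "\<And>V. V \<in> horizontal \<Longrightarrow> F (- V) = - F V" and Y: "Y \<in> horizontal"
  shows "average F (P Y) = P (average F Y)" "average F (Q Y) = Q (average F Y)" "average F (J Y) = J (average F Y)"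
  using Y by (simp_all add: average_def F) (simp_all add: fun_eq_iff algebra_simps)

text \<open>
  The correction with coefficient $\tfrac13$ is invisible for the Leibniz rule in \<open>Y\<close> after averaging,
  because $V \mapsto PV$ averages to zero (likewise \<open>Q\<close> and \<open>J\<close>), while in \<open>X\<close> it cancels the derivatives
  of the factor that the bracket leaves behind.
\<close>

definition hbracket3 :: "'a vfield \<Rightarrow> 'a vfield \<Rightarrow> 'a vfield" where
  "hbracket3 X Y = hbracket X Y - (\<lambda>_. 1/3) \<odot> (hbracket (P X) (P Y) + hbracket (Q X) (Q Y) - hbracket (J X) (J Y))"

definition obata :: "'a vfield \<Rightarrow> 'a vfield \<Rightarrow> 'a vfield" where
  "obata X Y = average (hbracket3 X) Y"

definition reeb_part :: "'a vfield \<Rightarrow> 'a vfield" where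
  "reeb_part Y = (\<lambda>_. 1/3) \<odot> br \<xi> Y + (\<lambda>_. 2/3) \<odot> average (br \<xi>) Y"

lemma hbracket3_hor [simp]: "X \<in> horizontal \<Longrightarrow> Y \<in> horizontal \<Longrightarrow> hbracket3 X Y \<in> horizontal"
  by (simp add: hbracket3_def)

lemma hbracket3_minus [simp]: "X \<in> horizontal \<Longrightarrow> Y \<in> horizontal \<Longrightarrow> hbracket3 X (- Y) = - hbracket3 X Y"
  by (simp add: hbracket3_def fun_eq_iff algebra_simps)

lemma obata_hor [simp]: "X \<in> horizontal \<Longrightarrow> Y \<in> horizontal \<Longrightarrow> obata X Y \<in> horizontal"
  by (simp add: obata_def average_def)

lemma reeb_part_hor [simp]: "Y \<in> horizontal \<Longrightarrow> reeb_part Y \<in> horizontal"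
  by (simp add: reeb_part_def average_def)

lemma obata_parallel:
  "X \<in> horizontal \<Longrightarrow> Y \<in> horizontal \<Longrightarrow> obata X (P Y) = P (obata X Y)"
  "X \<in> horizontal \<Longrightarrow> Y \<in> horizontal \<Longrightarrow> obata X (Q Y) = Q (obata X Y)"
  "X \<in> horizontal \<Longrightarrow> Y \<in> horizontal \<Longrightarrow> obata X (J Y) = J (obata X Y)"
  unfolding obata_def by (rule average_parallel; simp)+

text \<open>
  Only the unaveraged third of the Lie derivative fails to commute with the tensors.
\<close>

lemma reeb_part_parallel:
  assumes "Y \<in> horizontal"
  shows "reeb_part (P Y) - P (reeb_part Y) = (\<lambda>_. 1/3) \<odot> lie_derivative11 \<xi> \<phi>\<^sub>1 Y"
    "reeb_part (Q Y) - Q (reeb_part Y) = (\<lambda>_. 1/3) \<odot> lie_derivative11 \<xi> \<phi>\<^sub>2 Y"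
    "reeb_part (J Y) - J (reeb_part Y) = (\<lambda>_. 1/3) \<odot> lie_derivative11 \<xi> \<phi>\<^sub>3 Y"
proof -
  have average: "average (br \<xi>) (P Y) = P (average (br \<xi>) Y)" "average (br \<xi>) (Q Y) = Q (average (br \<xi>) Y)"
    "average (br \<xi>) (J Y) = J (average (br \<xi>) Y)"
    using assms by (auto intro!: average_parallel simp: bracket_minus_right)
  have "average (br \<xi>) Y \<in> VF"
    using assms by (simp add: average_def)
  then show "reeb_part (P Y) - P (reeb_part Y) = (\<lambda>_. 1/3) \<odot> lie_derivative11 \<xi> \<phi>\<^sub>1 Y"
    "reeb_part (Q Y) - Q (reeb_part Y) = (\<lambda>_. 1/3) \<odot> lie_derivative11 \<xi> \<phi>\<^sub>2 Y"
    "reeb_part (J Y) - J (reeb_part Y) = (\<lambda>_. 1/3) \<odot> lie_derivative11 \<xi> \<phi>\<^sub>3 Y"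
    using assms
    by (simp_all add: reeb_part_def average lie_derivative11_def) (simp_all add: fun_eq_iff algebra_simps)
qed

lemma hbracket3_add [simp]:
  "X \<in> horizontal \<Longrightarrow> Y \<in> horizontal \<Longrightarrow> Z \<in> horizontal \<Longrightarrow> hbracket3 X (Y + Z) = hbracket3 X Y + hbracket3 X Z"
  "X \<in> horizontal \<Longrightarrow> Y \<in> horizontal \<Longrightarrow> Z \<in> horizontal \<Longrightarrow> hbracket3 (X + Y) Z = hbracket3 X Z + hbracket3 Y Z"
  by (simp_all add: hbracket3_def) (simp_all add: fun_eq_iff algebra_simps)

lemma hbracket3_scale:
  assumes "X \<in> horizontal" "Y \<in> horizontal" "u \<in> SF"
  shows "hbracket3 X (u \<odot> Y) = u \<odot> hbracket3 X Y + act X u \<odot> Y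
      - (\<lambda>_. 1/3) \<odot> (act (P X) u \<odot> P Y + act (Q X) u \<odot> Q Y - act (J X) u \<odot> J Y)"
    "hbracket3 (u \<odot> X) Y = u \<odot> hbracket3 X Y - act Y u \<odot> X
      + (\<lambda>_. 1/3) \<odot> (act (P Y) u \<odot> P X + act (Q Y) u \<odot> Q X - act (J Y) u \<odot> J X)"
  using assms by (simp_all add: hbracket3_def) (simp_all add: fun_eq_iff algebra_simps)

lemma obata_add:
  "X \<in> horizontal \<Longrightarrow> Y \<in> horizontal \<Longrightarrow> Z \<in> horizontal \<Longrightarrow> obata X (Y + Z) = obata X Y + obata X Z"
  "X \<in> horizontal \<Longrightarrow> Y \<in> horizontal \<Longrightarrow> Z \<in> horizontal \<Longrightarrow> obata (X + Y) Z = obata X Z + obata Y Z"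
  by (simp_all add: obata_def average_def) (simp_all add: fun_eq_iff algebra_simps)

text \<open>
  In the second equation the average of $-(Y u)X$ is
  $-\tfrac14((Yu)X + (PYu)PX + (QYu)QX - (JYu)JX)$, and the average of the correction in
  \<open>hbracket3_scale\<close> is its negative.
\<close>

lemma obata_scale:
  assumes "X \<in> horizontal" "Y \<in> horizontal" "u \<in> SF"
  shows "obata X (u \<odot> Y) = u \<odot> obata X Y + act X u \<odot> Y"
    "obata (u \<odot> X) Y = u \<odot> obata X Y"
  using assms by (simp_all add: obata_def average_def hbracket3_scale act_minus_field)
    (simp_all add: fun_eq_iff algebra_simps)

lemma reeb_part_linear:
  "X \<in> horizontal \<Longrightarrow> Y \<in> horizontal \<Longrightarrow> reeb_part (X + Y) = reeb_part X + reeb_part Y"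
  "X \<in> horizontal \<Longrightarrow> u \<in> SF \<Longrightarrow> reeb_part (u \<odot> X) = u \<odot> reeb_part X + act \<xi> u \<odot> X"
  by (simp_all add: reeb_part_def average_def bracket_add_right bracket_scale_right)
    (simp_all add: fun_eq_iff algebra_simps)

text \<open>
  The brackets of images under two different ones of \<open>P\<close>, \<open>Q\<close>, \<open>J\<close> form an expression symmetric in \<open>X\<close>
  and \<open>Y\<close> and cancel.  What remains is the bracket and the horizontal part of
  $\tfrac16(-[P,P] - [Q,Q] + [J,J])$, where each of the three tensors contributes $-\tfrac16 B(X,Y)$.
\<close>

lemma obata_torsion:
  assumes [simp]: "X \<in> horizontal" "Y \<in> horizontal"
  shows "obata X Y - obata Y X = hbracket X Y + (\<lambda>_. 1/6) \<odot>
    (P (hbracket (P X) Y) + P (hbracket X (P Y)) + Q (hbracket (Q X) Y) + Q (hbracket X (Q Y)) - J (hbracket (J X) Y) - J (hbracket X (J Y))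
     - hbracket (P X) (P Y) - hbracket (Q X) (Q Y) + hbracket (J X) (J Y) - (\<lambda>_. 3) \<odot> hbracket X Y)"
  by (simp add: obata_def average_def hbracket3_def
      hbracket_swap[of X Y] hbracket_swap[of "P X" Y] hbracket_swap[of "Q X" Y] hbracket_swap[of "J X" Y]
      hbracket_swap[of X "P Y"] hbracket_swap[of "P X" "P Y"] hbracket_swap[of "Q X" "P Y"] hbracket_swap[of "J X" "P Y"]
      hbracket_swap[of X "Q Y"] hbracket_swap[of "P X" "Q Y"] hbracket_swap[of "Q X" "Q Y"] hbracket_swap[of "J X" "Q Y"]
      hbracket_swap[of X "J Y"] hbracket_swap[of "P X" "J Y"] hbracket_swap[of "Q X" "J Y"] hbracket_swap[of "J X" "J Y"])
    (simp add: fun_eq_iff algebra_simps)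

end

section \<open>Skew-symmetric tensorial maps\<close>

context manifold
begin

text \<open>
  Bilinearity over the functions follows by skew-symmetry from linearity in the first argument.
\<close>

definition skew_tensor :: "('a vfield \<Rightarrow> 'a vfield \<Rightarrow> 'a vfield) \<Rightarrow> bool" where
  "skew_tensor F \<longleftrightarrow>
     (\<forall>X\<in>VF. \<forall>Y\<in>VF. F Y X = - F X Y) \<and>
     (\<forall>X\<in>VF. \<forall>Y\<in>VF. \<forall>Z\<in>VF. F (X + Y) Z = F X Z + F Y Z) \<and>
     (\<forall>u\<in>SF. \<forall>X\<in>VF. \<forall>Y\<in>VF. F (u \<odot> X) Y = u \<odot> F X Y)"

lemma skew_tensorI:
  assumes "\<And>X Y. X \<in> VF \<Longrightarrow> Y \<in> VF \<Longrightarrow> F Y X = - F X Y"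
    and "\<And>X Y Z. X \<in> VF \<Longrightarrow> Y \<in> VF \<Longrightarrow> Z \<in> VF \<Longrightarrow> F (X + Y) Z = F X Z + F Y Z"
    and "\<And>u X Y. u \<in> SF \<Longrightarrow> X \<in> VF \<Longrightarrow> Y \<in> VF \<Longrightarrow> F (u \<odot> X) Y = u \<odot> F X Y"
  shows "skew_tensor F"
  unfolding skew_tensor_def using assms by blast

lemma skew_tensorD:
  assumes "skew_tensor F" "X \<in> VF" "Y \<in> VF"
  shows "F Y X = - F X Y"
    and "Z \<in> VF \<Longrightarrow> F (X + Y) Z = F X Z + F Y Z"
    and "u \<in> SF \<Longrightarrow> F (u \<odot> X) Y = u \<odot> F X Y"
  using assms unfolding skew_tensor_def by blast+

lemma skew_tensor_add:
  assumes "skew_tensor F" "skew_tensor G"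
  shows "skew_tensor (\<lambda>X Y. F X Y + G X Y)"
proof (rule skew_tensorI)
  fix X Y assume "X \<in> VF" "Y \<in> VF"
  then show "F Y X + G Y X = - (F X Y + G X Y)"
    using skew_tensorD(1)[OF assms(1), of X Y] skew_tensorD(1)[OF assms(2), of X Y] by simp
qed (simp_all add: skew_tensorD(2,3)[OF assms(1)] skew_tensorD(2,3)[OF assms(2)],
  simp_all add: fun_eq_iff algebra_simps)

lemma skew_tensor_scale:
  assumes "skew_tensor F"
  shows "skew_tensor (\<lambda>X Y. u \<odot> F X Y)"
proof (rule skew_tensorI)
  fix X Y assume "X \<in> VF" "Y \<in> VF"
  then show "u \<odot> F Y X = - (u \<odot> F X Y)"
    using skew_tensorD(1)[OF assms, of X Y] by (simp add: fun_eq_iff)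
qed (simp_all add: skew_tensorD(2,3)[OF assms], simp_all add: fun_eq_iff algebra_simps)

lemma skew_tensor_minus: "skew_tensor F \<Longrightarrow> skew_tensor (\<lambda>X Y. - F X Y)"
  unfolding uminus_vscale by (rule skew_tensor_scale)

lemma skew_tensor_diff: "skew_tensor F \<Longrightarrow> skew_tensor G \<Longrightarrow> skew_tensor (\<lambda>X Y. F X Y - G X Y)"
  using skew_tensor_add[OF _ skew_tensor_minus, of F G] by simp

lemma skew_tensor_tensor:
  assumes "skew_tensor F" "tensor_field11 A \<phi>"
  shows "skew_tensor (\<lambda>X Y. F (tapp \<phi> X) (tapp \<phi> Y))"
proof (rule skew_tensorI)
  fix X Y assume "X \<in> VF" "Y \<in> VF"
  then show "F (tapp \<phi> Y) (tapp \<phi> X) = - F (tapp \<phi> X) (tapp \<phi> Y)"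
    by (rule skew_tensorD(1)[OF assms(1) tapp_VF[OF assms(2)] tapp_VF[OF assms(2)]])
qed (simp_all add: tapp_VF[OF assms(2)] tapp_add[OF assms(2)] tapp_scale[OF assms(2)]
    skew_tensorD(2,3)[OF assms(1)])

lemma skew_tensor_ext_d:
  assumes \<eta>: "one_form A \<eta>"
  shows "skew_tensor (\<lambda>X Y. ext_d \<eta> X Y \<odot> Z)"
proof -
  have "ext_d \<eta> Y X = - ext_d \<eta> X Y" if "X \<in> VF" "Y \<in> VF" for X Y
    using that fapp_minus[OF \<eta>, of "lie_bracket X Y"]
    by (simp add: ext_d_def fun_eq_iff bracket_swap[of Y X] field_simps)
  note swap = this
  have "ext_d \<eta> (X + Y) Z = ext_d \<eta> X Z + ext_d \<eta> Y Z"
    if "X \<in> VF" "Y \<in> VF" "Z \<in> VF" for X Y Z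
    using that by (simp add: ext_d_def fun_eq_iff fapp_add[OF \<eta>] fapp_SF[OF \<eta>] bracket_add_left
        act_add act_add_field field_simps)
  note add = this
  have "ext_d \<eta> (u \<odot> X) Y = u * ext_d \<eta> X Y" if "u \<in> SF" "X \<in> VF" "Y \<in> VF" for u X Y
    using that by (simp add: ext_d_def fun_eq_iff fapp_scale[OF \<eta>] fapp_diff[OF \<eta>] fapp_SF[OF \<eta>]
        bracket_scale_left act_mult act_scale_field field_simps)
  note scale = this
  show ?thesis
  proof (rule skew_tensorI)
    fix X Y assume "X \<in> VF" "Y \<in> VF"
    from swap[OF this] show "ext_d \<eta> Y X \<odot> Z = - (ext_d \<eta> X Y \<odot> Z)"
      by (simp add: fun_eq_iff)
  qed (simp_all add: add scale, simp_all add: fun_eq_iff algebra_simps)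
qed

lemma skew_tensor_nijenhuis:
  assumes \<phi>: "tensor_field11 A \<phi>"
  shows "skew_tensor (nijenhuis \<phi>)"
proof -
  note [simp] = tapp_add[OF \<phi>] tapp_scale[OF \<phi>] tapp_VF[OF \<phi>] tapp_minus[OF \<phi>] tapp_diff[OF \<phi>]
  have "nijenhuis \<phi> Y X = - nijenhuis \<phi> X Y" if "X \<in> VF" "Y \<in> VF" for X Y
    using that
    by (simp add: nijenhuis_def bracket_swap[of Y X] bracket_swap[of "tapp \<phi> Y" X]
        bracket_swap[of Y "tapp \<phi> X"] bracket_swap[of "tapp \<phi> Y" "tapp \<phi> X"])
  moreover have "nijenhuis \<phi> (X + Y) Z = nijenhuis \<phi> X Z + nijenhuis \<phi> Y Z"
    if "X \<in> VF" "Y \<in> VF" "Z \<in> VF" for X Y Z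
    using that by (simp add: nijenhuis_def bracket_add_left)
  moreover have "nijenhuis \<phi> (u \<odot> X) Y = u \<odot> nijenhuis \<phi> X Y"
    if "u \<in> SF" "X \<in> VF" "Y \<in> VF" for u X Y
    using that by (simp add: nijenhuis_def bracket_scale_left) (simp add: fun_eq_iff algebra_simps)
  ultimately show ?thesis
    by (rule skew_tensorI)
qed

lemma skew_tensor_torsion:
  assumes "linear_connection A D"
  shows "skew_tensor (torsion D)"
proof -
  have D: "D (X + Y) Z = D X Z + D Y Z" "D Z (X + Y) = D Z X + D Z Y"
    "u \<in> SF \<Longrightarrow> D (u \<odot> X) Z = u \<odot> D X Z" "u \<in> SF \<Longrightarrow> D Z (u \<odot> X) = act Z u \<odot> X + u \<odot> D Z X"
    if "X \<in> VF" "Y \<in> VF" "Z \<in> VF" for X Y Z u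
    using that assms unfolding linear_connection_def by blast+
  show ?thesis
    by (rule skew_tensorI) (simp_all add: torsion_def D bracket_add_left bracket_scale_left,
      simp_all add: fun_eq_iff algebra_simps bracket_eq_iff)
qed

end

context bi_paracontact
begin

text \<open>
  Splitting $X = X_h + \eta(X)\xi$ and $Y = Y_h + \eta(Y)\xi$ leaves no term with \<open>\<xi>\<close> in both
  arguments, as such a term is zero by skew-symmetry.
\<close>

lemma skew_tensor_eqI:
  assumes F: "skew_tensor F" and G: "skew_tensor G"
    and \<xi>: "\<And>V. V \<in> horizontal \<Longrightarrow> F \<xi> V = G \<xi> V"
    and horizontal: "\<And>U V. U \<in> horizontal \<Longrightarrow> V \<in> horizontal \<Longrightarrow> F U V = G U V"
    and X: "X \<in> VF" and Y: "Y \<in> VF"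
  shows "F X Y = G X Y"
proof -
  have exp: "T X Y = T (hpart X) (hpart Y) + et X \<odot> T \<xi> (hpart Y) - et Y \<odot> T \<xi> (hpart X)"
    if T: "skew_tensor T" for T
  proof -
    have swap: "T V U = - T U V" if "U \<in> VF" "V \<in> VF" for U V
      using skew_tensorD(1)[OF T that] .
    have split: "T Z W = T (hpart Z) W + et Z \<odot> T \<xi> W" if "Z \<in> VF" "W \<in> VF" for Z W
    proof -
      have "T Z W = T (hpart Z + et Z \<odot> \<xi>) W" by (simp add: hpart_def)
      also have "\<dots> = T (hpart Z) W + et Z \<odot> T \<xi> W"
        using that by (simp add: skew_tensorD(2,3)[OF T])
      finally show ?thesis .
    qed
    have "T \<xi> \<xi> = 0"
      using swap[of \<xi> \<xi>] by (simp add: fun_eq_iff)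
    then have "T (hpart X) Y = T (hpart X) (hpart Y) - et Y \<odot> T \<xi> (hpart X)" "T \<xi> Y = T \<xi> (hpart Y)"
      using split[of Y "hpart X"] split[of Y \<xi>] swap[of Y "hpart X"] swap[of "hpart X" "hpart Y"]
        swap[of Y \<xi>] swap[of "hpart Y" \<xi>] X Y
      by simp_all
    then show ?thesis
      using split[OF X Y] by simp
  qed
  show ?thesis
    unfolding exp[OF F] exp[OF G] using X Y by (simp add: \<xi> horizontal)
qed

section \<open>The canonical connection\<close>

definition canonical_torsion :: "'a vfield \<Rightarrow> 'a vfield \<Rightarrow> 'a vfield" where
  "canonical_torsion X Y = ext_d \<eta> X Y \<odot> \<xi>
         + ((\<lambda>_. 1/3) * (- ext_d \<eta> (P X) (P Y)
                         - ext_d \<eta> (Q X) (Q Y)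
                         + ext_d \<eta> (J X) (J Y))) \<odot> \<xi>
         + (\<lambda>_. 1/6) \<odot> (- N1_para \<eta> \<xi> \<phi>\<^sub>1 X Y - N1_para \<eta> \<xi> \<phi>\<^sub>2 X Y + N1_cont \<eta> \<xi> \<phi>\<^sub>3 X Y)"

text \<open>
  Here the multiples of $d\eta(X,Y)\xi$ hidden in the three tensors $N^{(1)}$ are collected, which
  leaves a combination of maps known to be skew tensors.
\<close>

lemma canonical_torsion_alt:
  "canonical_torsion X Y = (\<lambda>_. 2) \<odot> (ext_d \<eta> X Y \<odot> \<xi>)
         + (\<lambda>_. 1/3) \<odot> (ext_d \<eta> (J X) (J Y) \<odot> \<xi> - ext_d \<eta> (P X) (P Y) \<odot> \<xi> - ext_d \<eta> (Q X) (Q Y) \<odot> \<xi>)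
         + (\<lambda>_. 1/6) \<odot> (nijenhuis \<phi>\<^sub>3 X Y - nijenhuis \<phi>\<^sub>1 X Y - nijenhuis \<phi>\<^sub>2 X Y)"
  by (simp add: canonical_torsion_def N1_para_def N1_cont_def fun_eq_iff numeral_fun_apply algebra_simps)

lemma skew_tensor_canonical_torsion: "skew_tensor canonical_torsion"
  unfolding canonical_torsion_alt[abs_def]
  by (intro skew_tensor_add skew_tensor_diff skew_tensor_scale skew_tensor_nijenhuis tensors
      skew_tensor_ext_d one_form skew_tensor_tensor[where F="\<lambda>X Y. ext_d \<eta> X Y \<odot> \<xi>"])

text \<open>
  The first summand is forced by $\nabla\xi = 0$ and the Leibniz rule, the other two split \<open>X\<close> into its
  components along \<open>\<xi>\<close> and in the kernel of \<open>\<eta>\<close>.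
\<close>

definition canonical_connection :: "'a vfield \<Rightarrow> 'a vfield \<Rightarrow> 'a vfield" where
  "canonical_connection X Y = (if X \<in> VF \<and> Y \<in> VF
     then act X (et Y) \<odot> \<xi> + et X \<odot> reeb_part (hpart Y) + obata (hpart X) (hpart Y) else 0)"

lemma linear_connection_canonical: "linear_connection A canonical_connection"
  unfolding linear_connection_def
proof (intro conjI ballI allI impI)
  fix X Y Z assume [simp]: "X \<in> VF" "Y \<in> VF" "Z \<in> VF"
  show "canonical_connection X Y \<in> VF"
    by (simp add: canonical_connection_def)
  show "canonical_connection (X + Y) Z = canonical_connection X Z + canonical_connection Y Z"
    by (simp add: canonical_connection_def act_add_field obata_add) (simp add: fun_eq_iff algebra_simps)
  show "canonical_connection X (Y + Z) = canonical_connection X Y + canonical_connection X Z"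
    by (simp add: canonical_connection_def act_add obata_add reeb_part_linear) (simp add: fun_eq_iff algebra_simps)
next
  fix X Y u assume [simp]: "X \<in> VF" "Y \<in> VF" "u \<in> SF"
  show "canonical_connection (u \<odot> X) Y = u \<odot> canonical_connection X Y"
    by (simp add: canonical_connection_def act_scale_field obata_scale) (simp add: fun_eq_iff algebra_simps)
  have "act X u = act (hpart X) u + et X * act \<xi> u"
    by (simp add: hpart_def act_def fun_eq_iff)
  then show "canonical_connection X (u \<odot> Y) = act X u \<odot> Y + u \<odot> canonical_connection X Y"
    by (simp add: canonical_connection_def act_mult obata_scale reeb_part_linear)
      (simp add: fun_eq_iff algebra_simps hpart_def[of Y])
qed (auto simp: canonical_connection_def)

lemma obata_0 [simp]: "X \<in> horizontal \<Longrightarrow> obata X 0 = 0" "X \<in> horizontal \<Longrightarrow> obata 0 X = 0"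
  using obata_scale(1)[of X 0 0] obata_scale(2)[of 0 X 0] by (simp_all add: act_const)

lemma reeb_part_0 [simp]: "reeb_part 0 = 0"
  by (simp add: reeb_part_def average_def)

lemma canonical_connection_\<xi>: "X \<in> VF \<Longrightarrow> canonical_connection X \<xi> = 0"
  by (simp add: canonical_connection_def act_const)

text \<open>
  Since $[\xi, u\xi] = (\xi u)\xi$ is killed by the three tensors, as is \<open>\<xi>\<close> itself, the Lie derivatives
  do not see the component along \<open>\<xi>\<close>.
\<close>

lemma lie_derivative_hpart:
  assumes "X \<in> VF"
  shows "lie_derivative11 \<xi> \<phi>\<^sub>1 X = lie_derivative11 \<xi> \<phi>\<^sub>1 (hpart X)"
    "lie_derivative11 \<xi> \<phi>\<^sub>2 X = lie_derivative11 \<xi> \<phi>\<^sub>2 (hpart X)"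
    "lie_derivative11 \<xi> \<phi>\<^sub>3 X = lie_derivative11 \<xi> \<phi>\<^sub>3 (hpart X)"
proof -
  have "br \<xi> X = br \<xi> (hpart X + et X \<odot> \<xi>)" by (simp add: hpart_def)
  also have "\<dots> = br \<xi> (hpart X) + act \<xi> (et X) \<odot> \<xi>"
    using assms by (simp add: bracket_add_right bracket_scale_right del: hpart_linear)
  finally show "lie_derivative11 \<xi> \<phi>\<^sub>1 X = lie_derivative11 \<xi> \<phi>\<^sub>1 (hpart X)"
    "lie_derivative11 \<xi> \<phi>\<^sub>2 X = lie_derivative11 \<xi> \<phi>\<^sub>2 (hpart X)"
    "lie_derivative11 \<xi> \<phi>\<^sub>3 X = lie_derivative11 \<xi> \<phi>\<^sub>3 (hpart X)"
    using assms by (simp_all add: lie_derivative11_def)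
qed

lemma canonical_connection_parallel:
  assumes \<phi>: "\<phi> \<in> {\<phi>\<^sub>1, \<phi>\<^sub>2, \<phi>\<^sub>3}" and [simp]: "X \<in> VF" "Y \<in> VF"
  shows "cov_deriv11 canonical_connection \<phi> X Y = (\<lambda>p. 2/3 * fapp \<eta> X p) \<odot> h_tensor \<xi> \<phi> Y"
proof -
  have reeb_part: "reeb_part (tapp \<phi> (hpart Y)) - tapp \<phi> (reeb_part (hpart Y)) = (\<lambda>_. 1/3) \<odot> lie_derivative11 \<xi> \<phi> Y"
    and obata: "obata (hpart X) (tapp \<phi> (hpart Y)) = tapp \<phi> (obata (hpart X) (hpart Y))"
    and \<phi>Y: "et (tapp \<phi> Y) = 0" "tapp \<phi> Y \<in> VF" "tapp \<phi> \<xi> = 0" "tapp \<phi> (hpart Y) = tapp \<phi> Y"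
    using \<phi> reeb_part_parallel[of "hpart Y"] obata_parallel[of "hpart X" "hpart Y"] lie_derivative_hpart[of Y] by auto
  have "tensor_field11 A \<phi>" using \<phi> tensors by auto
  note [simp] = tapp_add[OF this] tapp_scale[OF this]
  have "hpart (tapp \<phi> Y) = tapp \<phi> Y" using \<phi>Y by (simp add: hpart_def)
  then have "cov_deriv11 canonical_connection \<phi> X Y
      = et X \<odot> (reeb_part (tapp \<phi> (hpart Y)) - tapp \<phi> (reeb_part (hpart Y)))"
    using obata by (simp add: cov_deriv11_def canonical_connection_def \<phi>Y act_const)
      (simp add: fun_eq_iff algebra_simps)
  then show ?thesis
    by (simp add: reeb_part h_tensor_def fun_eq_iff)
qed

lemma torsion_canonical_connection:
  assumes "X \<in> VF" "Y \<in> VF"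
  shows "torsion canonical_connection X Y = canonical_torsion X Y"
proof (rule skew_tensor_eqI[OF _ _ _ _ assms])
  show "skew_tensor (torsion canonical_connection)"
    by (rule skew_tensor_torsion[OF linear_connection_canonical])
  show "skew_tensor canonical_torsion"
    by (rule skew_tensor_canonical_torsion)
next
  fix V assume [simp]: "V \<in> horizontal"
  have "ext_d \<eta> \<xi> V = 0" using reeb by (simp add: reeb_field_def)
  moreover have "ext_d \<eta> 0 W = 0" if "W \<in> VF" for W
    using that by (simp add: ext_d_def fun_eq_iff act_zero_field act_const)
  ultimately show "torsion canonical_connection \<xi> V = canonical_torsion \<xi> V"
    by (simp add: torsion_def canonical_connection_def act_const canonical_torsion_alt nijenhuis_def
        reeb_part_def average_def) (simp add: fun_eq_iff algebra_simps)
next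
  fix U V assume [simp]: "U \<in> horizontal" "V \<in> horizontal"
  have d: "ext_d \<eta> X Y = (\<lambda>_. - 1/2) * et (br X Y)" if "X \<in> horizontal" "Y \<in> horizontal" for X Y
    using that by (simp add: ext_d_def fun_eq_iff act_const)
  \<comment> \<open>the vertical part of the bracket of horizontal fields is $-2\,d\eta$\<close>
  have br: "br X Y = hbracket X Y - (\<lambda>_. 2) \<odot> (ext_d \<eta> X Y \<odot> \<xi>)" if "X \<in> horizontal" "Y \<in> horizontal" for X Y
    using that by (simp add: d hbracket_def hpart_def fun_eq_iff)
  have [simp]: "ext_d \<eta> X Y \<in> SF" if "X \<in> horizontal" "Y \<in> horizontal" for X Y
    using that by (simp add: d)
  have "torsion canonical_connection U V = obata U V - obata V U - br U V"
    by (simp add: torsion_def canonical_connection_def act_const)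
  then show "torsion canonical_connection U V = canonical_torsion U V"
    by (simp add: obata_torsion canonical_torsion_alt nijenhuis_def br)
      (simp add: fun_eq_iff algebra_simps)
qed

section \<open>Uniqueness\<close>

text \<open>
  The two ways of moving \<open>P\<close> and \<open>Q\<close> out of $S(PX, QY)$ give opposite signs, because \<open>P\<close> and \<open>Q\<close>
  anticommute.
\<close>

lemma connection_unique:
  assumes D: "linear_connection A D" and D': "linear_connection A D'"
    and \<xi>: "\<And>X. X \<in> VF \<Longrightarrow> D X \<xi> = D' X \<xi>"
    and \<phi>: "\<And>\<phi> X Y. \<phi> \<in> {\<phi>\<^sub>1, \<phi>\<^sub>2} \<Longrightarrow> X \<in> VF \<Longrightarrow> Y \<in> VF \<Longrightarrow>
      cov_deriv11 D \<phi> X Y = cov_deriv11 D' \<phi> X Y"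
    and tor: "\<And>X Y. X \<in> VF \<Longrightarrow> Y \<in> VF \<Longrightarrow> torsion D X Y = torsion D' X Y"
  shows "D = D'"
proof -
  define S where "S X Y = D X Y - D' X Y" for X Y
  have VF: "D X Y \<in> VF" "D' X Y \<in> VF" "S X Y \<in> VF" if "X \<in> VF" "Y \<in> VF" for X Y
    using that D D' by (auto simp: linear_connection_def S_def)
  have sym: "S X Y = S Y X" if "X \<in> VF" "Y \<in> VF" for X Y
    using tor[OF that] by (simp add: S_def torsion_def fun_eq_iff algebra_simps)
  have S_P: "S X (P Y) = P (S X Y)" and S_Q: "S X (Q Y) = Q (S X Y)" if "X \<in> VF" "Y \<in> VF" for X Y
    using \<phi>[of \<phi>\<^sub>1 X Y] \<phi>[of \<phi>\<^sub>2 X Y] VF that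
    by (simp_all add: S_def cov_deriv11_def) (simp_all add: fun_eq_iff algebra_simps)
  have S_hpart: "S X (hpart Y) = S X Y" if [simp]: "X \<in> VF" "Y \<in> VF" for X Y
  proof -
    have exp: "C X Y = C X (hpart Y) + (act X (et Y) \<odot> \<xi> + et Y \<odot> C X \<xi>)" if "linear_connection A C" for C
    proof -
      have "C X Y = C X (hpart Y + et Y \<odot> \<xi>)" by (simp add: hpart_def)
      also have "\<dots> = C X (hpart Y) + (act X (et Y) \<odot> \<xi> + et Y \<odot> C X \<xi>)"
        using that by (simp add: linear_connection_def)
      finally show ?thesis .
    qed
    show ?thesis
      unfolding S_def using exp[OF D] exp[OF D'] \<xi>[of X] by simp
  qed
  \<comment> \<open>\<open>P\<close> applied twice is the identity modulo \<open>\<xi>\<close>, which \<open>S X\<close> annihilates\<close>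
  have horizontal: "S X Y \<in> horizontal" if [simp]: "X \<in> VF" "Y \<in> VF" for X Y
  proof -
    have "P (P (S X Y)) = S X (P (P Y))" by (simp add: S_P)
    also have "\<dots> = S X (hpart Y)" by (simp add: PP hpart_def)
    finally have "S X Y = P (P (S X Y))" by (simp add: S_hpart)
    then show ?thesis using VF horizontal_closed(6) P_rules(1) that by metis
  qed
  have "S X Y = 0" if [simp]: "X \<in> VF" "Y \<in> VF" for X Y
  proof -
    note [simp] = horizontal VF
    have "S (P X) (Q Y) = Q (S Y (P X))"
      by (simp add: S_Q sym[of "P X"])
    then have 1: "S (P X) (Q Y) = - J (S X Y)"
      by (simp add: S_P sym[of Y])
    have "S (P X) (Q Y) = P (S X (Q Y))"
      by (simp add: S_P sym[of "P X"] sym[of _ X])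
    then have 2: "S (P X) (Q Y) = J (S X Y)"
      by (simp add: S_Q)
    have "J (S X Y) = 0"
      using 1 2 by (simp add: fun_eq_iff)
    then have "J (J (S X Y)) = 0" by simp
    then show ?thesis by simp
  qed
  then have in_VF: "D X Y = D' X Y" if "X \<in> VF" "Y \<in> VF" for X Y
    using that by (simp add: S_def)
  have outside: "D X Y = D' X Y" if "X \<notin> VF \<or> Y \<notin> VF" for X Y
    using that D D' unfolding linear_connection_def by metis
  show ?thesis
  proof (rule ext, rule ext)
    show "D X Y = D' X Y" for X Y using in_VF outside by blast
  qed
qed

end

section \<open>Existence and uniqueness of the canonical connection\<close>

theorem theorem4p4:
  fixes A :: "('a::{t2_space,second_countable_topology}, 'e::euclidean_space) atlas"
    and n :: nat and \<eta> :: "'a form1" and \<xi> :: "'a vfield"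
    and \<phi>\<^sub>1 \<phi>\<^sub>2 \<phi>\<^sub>3 :: "'a tensor11"
  assumes "contact_manifold A n \<eta>"
    and "reeb_field A \<eta> \<xi>"
    and "almost_bi_paracontact A \<eta> \<xi> \<phi>\<^sub>1 \<phi>\<^sub>2 \<phi>\<^sub>3"
  shows "\<exists>!D. linear_connection A D \<and>
    (\<forall>X\<in>vector_fields A. D X \<xi> = 0) \<and>
    (\<forall>\<phi>\<in>{\<phi>\<^sub>1, \<phi>\<^sub>2, \<phi>\<^sub>3}. \<forall>X\<in>vector_fields A. \<forall>Y\<in>vector_fields A.
       cov_deriv11 D \<phi> X Y = (\<lambda>p. 2/3 * fapp \<eta> X p) \<odot> h_tensor \<xi> \<phi> Y) \<and>
    (\<forall>X\<in>vector_fields A. \<forall>Y\<in>vector_fields A.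
       torsion D X Y =
         ext_d \<eta> X Y \<odot> \<xi>
         + ((\<lambda>_. 1/3) * (- ext_d \<eta> (tapp \<phi>\<^sub>1 X) (tapp \<phi>\<^sub>1 Y)
                         - ext_d \<eta> (tapp \<phi>\<^sub>2 X) (tapp \<phi>\<^sub>2 Y)
                         + ext_d \<eta> (tapp \<phi>\<^sub>3 X) (tapp \<phi>\<^sub>3 Y))) \<odot> \<xi>
         + (\<lambda>_. 1/6) \<odot> (- N1_para \<eta> \<xi> \<phi>\<^sub>1 X Y - N1_para \<eta> \<xi> \<phi>\<^sub>2 X Y + N1_cont \<eta> \<xi> \<phi>\<^sub>3 X Y))"
    (is "\<exists>!D. ?canonical D")
proof -
  interpret bi_paracontact A \<eta> \<xi> \<phi>\<^sub>1 \<phi>\<^sub>2 \<phi>\<^sub>3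
    using assms by unfold_locales (auto simp: contact_manifold_def)
  show ?thesis
  proof (rule ex1I)
    show "?canonical canonical_connection"
      by (intro conjI ballI linear_connection_canonical canonical_connection_\<xi>
          canonical_connection_parallel torsion_canonical_connection[unfolded canonical_torsion_def])
  next
    fix D assume D: "?canonical D"
    note parallel = D[THEN conjunct2, THEN conjunct2, THEN conjunct1, rule_format]
      and torsion = D[THEN conjunct2, THEN conjunct2, THEN conjunct2, rule_format]
    show "D = canonical_connection"
    proof (rule connection_unique)
      show "linear_connection A D" using D by blast
      show "linear_connection A canonical_connection" by (rule linear_connection_canonical)
    next
      fix X assume "X \<in> VF"
      then show "D X \<xi> = canonical_connection X \<xi>" using D canonical_connection_\<xi> by simp
    next
      fix \<phi> X Y assume "\<phi> \<in> {\<phi>\<^sub>1, \<phi>\<^sub>2}" and XY: "X \<in> VF" "Y \<in> VF"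
      then have \<phi>: "\<phi> \<in> {\<phi>\<^sub>1, \<phi>\<^sub>2, \<phi>\<^sub>3}" by blast
      show "cov_deriv11 D \<phi> X Y = cov_deriv11 canonical_connection \<phi> X Y"
        unfolding parallel[OF \<phi> XY] canonical_connection_parallel[OF \<phi> XY] ..
    next
      fix X Y assume XY: "X \<in> VF" "Y \<in> VF"
      show "torsion D X Y = torsion canonical_connection X Y"
        unfolding torsion[OF XY] torsion_canonical_connection[OF XY] canonical_torsion_def ..
    qed
  qed
qed

end
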